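(* Let $L=2^{3n+11}\lambda$. The verifiable tomography scheme $(\mathsf{Tomography},\mathsf{Verify})$ described in the context satisfies $L$-same-input correctness: for every $\mathbf x=(k,i,b)\in\{0,1\}^\lambda\times\{0,1\}^d\times\{0,1\}$, $$\Pr\left[\mathsf{Verify}\left(\mathbf x,\ \mathsf{Tomography}\left(\Phi_\lambda(\mathbf x)^{\otimes L}\right)\right)=\mathsf{Valid}\right]\ge1-\mathrm{negl}(\lambda).$$
   Context: Setting. $d(\lambda)=n(\lambda)=\lceil\log_2\lambda\rceil$. $G$ is a $(d+1,n)$-PRFS generator, i.e. a QPT algorithm that on $k\in\{0,1\}^\lambda$ and $x\in\{0,1\}^{d+1}$ outputs an $n$-qubit (possibly mixed) state $G_\lambda(k,x)$, such that polynomially many copies of the outputs on any fixed polynomially many inputs are, for a uniformly random $k$, computationally indistinguishable (by non-uniform QPT distinguishers given the inputs) from copies of independent Haar-random $n$-qubit states; and $G$ has the recognizable abort property: $G_\lambda(k,x)$ is obtained by tracing out the first qubit of $\widehat G_\lambda(k,x)=\eta_{k,x}|0\rangle\langle0|\otimes|\psi_{k,x}\rangle\langle\psi_{k,x}|+(1-\eta_{k,x})|\bot\rangle\langle\bot|$ where $\eta_{k,x}\in[0,1]$, $|\psi_{k,x}\rangle$ is an $n$-qubit pure state and $|\bot\rangle=|1\rangle|\widehat\bot\rangle$ is a fixed $(n+1)$-qubit state. For $k\in\{0,1\}^\lambda,i\in\{0,1\}^d,b\in\{0,1\}$ let $\Phi_\lambda(k,i,b)=G_\lambda(k,i\|b)$.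 Tomography. $\mathcal T$ is a tomography procedure that given $sN^2$ copies of an $N$-dimensional density matrix $\rho$ outputs a matrix $M$ with $\mathbb E\|M-\rho\|_F^2\le N/s$ (such a procedure exists). $\mathcal T_{\rm imp}$, given $4sN^2\lambda$ copies of $\rho$, runs $\mathcal T(\rho^{\otimes4sN^2})$ independently $\lambda$ times to get $M_1,\dots,M_\lambda$ and outputs some $M_{i^*}$ with $|\{j:\|M_j-M_{i^*}\|_F^2\le4N/s\}|>\lambda/2$, or a failure symbol if none exists. $\mathsf{Tomography}(\rho^{\otimes L})=\mathcal T_{\rm imp}(\rho^{\otimes L})$ with $N=2^n$, $s=2^{n+9}$. $\mathsf{Verify}(\mathbf x,M)$: compute $\widehat M\leftarrow\mathsf{Tomography}(\Phi_\lambda(\mathbf x)^{\otimes L})$ and output $\mathsf{Valid}$ if $\|M-\widehat M\|_F^2\le\frac9{128}$, and $\mathsf{Invalid}$ otherwise (also upon failure symbols). $\|\cdot\|_F$ is the Frobenius norm. *)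

theory Defs
  imports
    "HOL-Probability.Probability"
    "Jordan_Normal_Form.Schur_Decomposition"
begin

section \<open>Asymptotics\<close>

definition negligible :: "(nat \<Rightarrow> real) \<Rightarrow> bool" where
  "negligible f \<longleftrightarrow> (\<forall>c::nat. \<forall>\<^sub>F l in sequentially. \<bar>f l\<bar> < 1 / real l ^ c)"

definition poly_bounded :: "(nat \<Rightarrow> nat) \<Rightarrow> bool" where
  "poly_bounded f \<longleftrightarrow> (\<exists>c. \<forall>l\<ge>1. f l \<le> l ^ c + c)"

definition clog2 :: "nat \<Rightarrow> nat" where
  "clog2 l = nat \<lceil>log 2 (real l)\<rceil>"


section \<open>Finite-dimensional quantum states\<close>

definition mtrace :: "complex mat \<Rightarrow> complex" where
  "mtrace A = (\<Sum>i<dim_row A. A $$ (i, i))"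

text \<open>In the order of \<^theory>\<open>HOL-Library.Complex_Order\<close>, \<open>0 \<le> z\<close> says that \<open>z\<close> is real and nonnegative;
  over the complex numbers the condition therefore includes Hermiticity.\<close>

definition psd :: "nat \<Rightarrow> complex mat \<Rightarrow> bool" where
  "psd D A \<longleftrightarrow> A \<in> carrier_mat D D \<and> (\<forall>v \<in> carrier_vec D. 0 \<le> (A *\<^sub>v v) \<bullet>c v)"

definition density :: "nat \<Rightarrow> complex mat \<Rightarrow> bool" where
  "density D \<rho> \<longleftrightarrow> psd D \<rho> \<and> mtrace \<rho> = 1"

definition unit_state :: "nat \<Rightarrow> complex vec \<Rightarrow> bool" where
  "unit_state D v \<longleftrightarrow> v \<in> carrier_vec D \<and> v \<bullet>c v = 1"

definition proj :: "complex vec \<Rightarrow> complex mat" where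
  "proj v = Matrix.mat (dim_vec v) (dim_vec v) (\<lambda>(i, j). v $ i * cnj (v $ j))"

definition kron :: "complex mat \<Rightarrow> complex mat \<Rightarrow> complex mat" where
  "kron A B = Matrix.mat (dim_row A * dim_row B) (dim_col A * dim_col B)
     (\<lambda>(i, j). A $$ (i div dim_row B, j div dim_col B) * B $$ (i mod dim_row B, j mod dim_col B))"

definition kron_list :: "complex mat list \<Rightarrow> complex mat" where
  "kron_list As = foldr kron As (1\<^sub>m 1)"

text \<open>Partial traces of an operator on the tensor product of an \<open>A\<close>- and a \<open>B\<close>-dimensional space.\<close>

definition ptrace_first :: "nat \<Rightarrow> nat \<Rightarrow> complex mat \<Rightarrow> complex mat" where
  "ptrace_first A B \<rho> = Matrix.mat B B (\<lambda>(i, j). \<Sum>l<A. \<rho> $$ (l * B + i, l * B + j))"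

definition ptrace_last :: "nat \<Rightarrow> nat \<Rightarrow> complex mat \<Rightarrow> complex mat" where
  "ptrace_last A B \<rho> = Matrix.mat A A (\<lambda>(i, j). \<Sum>l<B. \<rho> $$ (i * B + l, j * B + l))"

definition ket_bit :: "bool \<Rightarrow> complex vec" where
  "ket_bit b = unit_vec 2 (of_bool b)"

definition bits_state :: "bool list \<Rightarrow> complex mat" where
  "bits_state bs = kron_list (map (\<lambda>b. proj (ket_bit b)) bs)"

definition frob :: "complex mat \<Rightarrow> real" where
  "frob A = sqrt (\<Sum>i<dim_row A. \<Sum>j<dim_col A. (cmod (A $$ (i, j)))\<^sup>2)"


section \<open>Quantum circuits\<close>

text \<open>Circuits over the universal gate set Hadamard, T, CNOT. Qubit \<open>0\<close> is the leftmost tensor factor,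
  i.e. the most significant bit of a basis index. A circuit \<open>(a, gs)\<close> adjoins \<open>a\<close> ancilla
  qubits in state zero to its input, applies the gates \<open>gs\<close>, and traces out all but the leading
  output qubits; intermediate measurements are deferred in the usual way.\<close>

datatype gate = Had nat | TGate nat | CNOT nat nat

type_synonym circuit = "nat \<times> gate list"

definition lift1 :: "nat \<Rightarrow> nat \<Rightarrow> (bool \<Rightarrow> bool \<Rightarrow> complex) \<Rightarrow> complex mat" where
  "lift1 w q u = Matrix.mat (2 ^ w) (2 ^ w) (\<lambda>(i, j).
     if \<forall>p<w. p \<noteq> q \<longrightarrow> bit i (w - 1 - p) = bit j (w - 1 - p)
     then u (bit i (w - 1 - q)) (bit j (w - 1 - q)) else 0)"

fun gate_mat :: "nat \<Rightarrow> gate \<Rightarrow> complex mat" where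
  "gate_mat w (Had q) = lift1 w q (\<lambda>x y. (if x \<and> y then - 1 else 1) / complex_of_real (sqrt 2))"
| "gate_mat w (TGate q) = lift1 w q (\<lambda>x y. if x = y then (if x then cis (pi / 4) else 1) else 0)"
| "gate_mat w (CNOT p q) = Matrix.mat (2 ^ w) (2 ^ w) (\<lambda>(i, j).
     if i = (if bit j (w - 1 - p) then flip_bit (w - 1 - q) j else j) then 1 else 0)"

fun gate_wf :: "nat \<Rightarrow> gate \<Rightarrow> bool" where
  "gate_wf w (Had q) \<longleftrightarrow> q < w"
| "gate_wf w (TGate q) \<longleftrightarrow> q < w"
| "gate_wf w (CNOT p q) \<longleftrightarrow> p < w \<and> q < w \<and> p \<noteq> q"

definition circuit_unitary :: "nat \<Rightarrow> gate list \<Rightarrow> complex mat" where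
  "circuit_unitary w gs = foldl (\<lambda>U g. gate_mat w g * U) (1\<^sub>m (2 ^ w)) gs"

definition circuit_wf :: "nat \<Rightarrow> nat \<Rightarrow> circuit \<Rightarrow> bool" where
  "circuit_wf m n C \<longleftrightarrow> n \<le> m + fst C \<and> (\<forall>g \<in> set (snd C). gate_wf (m + fst C) g)"

definition circuit_out :: "nat \<Rightarrow> nat \<Rightarrow> circuit \<Rightarrow> complex mat \<Rightarrow> complex mat" where
  "circuit_out m n C \<rho> =
     (let w = m + fst C; U = circuit_unitary w (snd C)
      in ptrace_last (2 ^ n) (2 ^ (w - n))
           (U * kron \<rho> (bits_state (replicate (fst C) False)) * mat_adjoint U))"

definition accept_prob :: "nat \<Rightarrow> circuit \<Rightarrow> complex mat \<Rightarrow> real" where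
  "accept_prob m C \<rho> = Re (circuit_out m 1 C \<rho> $$ (1, 1))"

definition circuit_size :: "circuit \<Rightarrow> nat" where
  "circuit_size C = fst C + length (snd C)"

definition enc_nat :: "nat \<Rightarrow> bool list" where
  "enc_nat k = replicate k True @ [False]"

fun enc_gate :: "gate \<Rightarrow> bool list" where
  "enc_gate (Had q) = enc_nat 0 @ enc_nat q"
| "enc_gate (TGate q) = enc_nat 1 @ enc_nat q"
| "enc_gate (CNOT p q) = enc_nat 2 @ enc_nat p @ enc_nat q"

definition enc_circuit :: "circuit \<Rightarrow> bool list" where
  "enc_circuit C = enc_nat (fst C) @ concat (map enc_gate (snd C))"


section \<open>Uniformity\<close>

text \<open>Deterministic one-tape Turing machines with finitely many states (\<open>0\<close> initial, \<open>1\<close> halting)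
  and finitely many symbols (\<open>0\<close> blank, \<open>1\<close> and \<open>2\<close> the two bits). A configuration
  consists of the state, the head position and the tape.\<close>

type_synonym tm = "nat \<Rightarrow> nat \<Rightarrow> nat \<times> nat \<times> int"

definition tm_wf :: "nat \<Rightarrow> nat \<Rightarrow> tm \<Rightarrow> bool" where
  "tm_wf Q S \<delta> \<longleftrightarrow> Q \<ge> 2 \<and> S \<ge> 3 \<and>
     (\<forall>q<Q. \<forall>a<S. case \<delta> q a of (q', a', mv) \<Rightarrow> q' < Q \<and> a' < S \<and> mv \<in> {-1, 0, 1})"

fun tm_step :: "tm \<Rightarrow> nat \<times> int \<times> (int \<Rightarrow> nat) \<Rightarrow> nat \<times> int \<times> (int \<Rightarrow> nat)" where
  "tm_step \<delta> (q, h, tape) =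
     (if q = 1 then (q, h, tape)
      else case \<delta> q (tape h) of (q', a', mv) \<Rightarrow> (q', h + mv, tape(h := a')))"

definition tape_of :: "bool list \<Rightarrow> int \<Rightarrow> nat" where
  "tape_of bs i = (if 0 \<le> i \<and> i < int (length bs) then (if bs ! nat i then 2 else 1) else 0)"

text \<open>The function mapping the string of \<open>l\<close> ones to \<open>f l\<close> is computable in polynomial time.\<close>

definition poly_time_unary :: "(nat \<Rightarrow> bool list) \<Rightarrow> bool" where
  "poly_time_unary f \<longleftrightarrow> (\<exists>Q S \<delta> c. tm_wf Q S \<delta> \<and>
     (\<forall>l\<ge>1. \<exists>t \<le> l ^ c + c. \<exists>h.
        (tm_step \<delta> ^^ t) (0, 0, tape_of (replicate l True)) = (1, h, tape_of (f l))))"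


section \<open>Haar-random states\<close>

definition unitary_mat :: "nat \<Rightarrow> complex mat \<Rightarrow> bool" where
  "unitary_mat N U \<longleftrightarrow> U \<in> carrier_mat N N \<and> U * mat_adjoint U = 1\<^sub>m N"

text \<open>\<open>\<mu>\<close> is the unitarily invariant probability measure on the unit sphere of complex
  \<open>N\<close>-space; a vector is given by its coordinate function on the indices below \<open>N\<close>.\<close>

definition haar_state :: "nat \<Rightarrow> (nat \<Rightarrow> complex) measure \<Rightarrow> bool" where
  "haar_state N \<mu> \<longleftrightarrow> prob_space \<mu> \<and> sets \<mu> = sets (\<Pi>\<^sub>M i\<in>{..<N}. borel) \<and>
     (AE f in \<mu>. (\<Sum>i<N. (cmod (f i))\<^sup>2) = 1) \<and>
     (\<forall>U. unitary_mat N U \<longrightarrow>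
        distr \<mu> \<mu> (\<lambda>f. \<lambda>i\<in>{..<N}. \<Sum>j<N. U $$ (i, j) * f j) = \<mu>)"


section \<open>Pseudorandom function-like state generators\<close>

text \<open>\<open>G l k x\<close> is the density matrix output on key \<open>k\<close> (of length \<open>l\<close>) and input \<open>x\<close>.\<close>

type_synonym generator = "nat \<Rightarrow> bool list \<Rightarrow> bool list \<Rightarrow> complex mat"

definition qpt_generator :: "(nat \<Rightarrow> nat) \<Rightarrow> (nat \<Rightarrow> nat) \<Rightarrow> generator \<Rightarrow> bool" where
  "qpt_generator d n G \<longleftrightarrow> (\<exists>C. poly_time_unary (\<lambda>l. enc_circuit (C l)) \<and>
     (\<forall>l\<ge>1. circuit_wf (l + d l) (n l) (C l) \<and>
        (\<forall>k x. length k = l \<and> length x = d l \<longrightarrow>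
           density (2 ^ n l) (G l k x) \<and>
           G l k x = circuit_out (l + d l) (n l) (C l) (bits_state (k @ x)))))"

text \<open>The input to a distinguisher: the indices \<open>xs\<close>, then \<open>t\<close> copies of each of the
  states \<open>\<rho>s\<close>, then its advice state.\<close>

definition dist_input :: "bool list list \<Rightarrow> nat \<Rightarrow> complex mat list \<Rightarrow> complex mat \<Rightarrow> complex mat" where
  "dist_input xs t \<rho>s \<alpha> =
     kron (bits_state (concat xs)) (kron (kron_list (concat (map (replicate t) \<rho>s))) \<alpha>)"

definition real_prob ::
  "generator \<Rightarrow> nat \<Rightarrow> nat \<Rightarrow> circuit \<Rightarrow> bool list list \<Rightarrow> nat \<Rightarrow> complex mat \<Rightarrow> real" where
  "real_prob G l m C xs t \<alpha> =
     (\<Sum>k | length k = l. accept_prob m C (dist_input xs t (map (G l k) xs) \<alpha>)) / 2 ^ l"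

definition ideal_prob ::
  "(nat \<Rightarrow> complex) measure \<Rightarrow> nat \<Rightarrow> nat \<Rightarrow> circuit \<Rightarrow> bool list list \<Rightarrow> nat \<Rightarrow> complex mat \<Rightarrow> real" where
  "ideal_prob \<mu> N m C xs t \<alpha> =
     (\<integral>\<theta>. accept_prob m C
        (dist_input xs t (map (\<lambda>i. proj (vec N (\<theta> i))) [0..<length xs]) \<alpha>)
      \<partial>(\<Pi>\<^sub>M i\<in>{..<length xs}. \<mu>))"

text \<open>Non-uniform QPT distinguishers are polynomial-size circuit families \<open>C\<close> with quantum advice
  states \<open>\<alpha>\<close> on \<open>r\<close> qubits. The indices form a set, hence distinctness of the lists \<open>xs l\<close>.\<close>

definition prfs :: "(nat \<Rightarrow> nat) \<Rightarrow> (nat \<Rightarrow> nat) \<Rightarrow> generator \<Rightarrow> bool" where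
  "prfs d n G \<longleftrightarrow> qpt_generator d n G \<and>
     (\<forall>\<mu> xs t C r \<alpha>.
        let m = (\<lambda>l. length (xs l) * d l + length (xs l) * t l * n l + r l) in
        (\<forall>l\<ge>1. haar_state (2 ^ n l) (\<mu> l)) \<and>
        poly_bounded (\<lambda>l. length (xs l)) \<and> poly_bounded t \<and>
        (\<forall>l\<ge>1. distinct (xs l) \<and> (\<forall>x \<in> set (xs l). length x = d l)) \<and>
        poly_bounded r \<and> (\<forall>l\<ge>1. density (2 ^ r l) (\<alpha> l)) \<and>
        poly_bounded (\<lambda>l. circuit_size (C l)) \<and> (\<forall>l\<ge>1. circuit_wf (m l) 1 (C l))
        \<longrightarrow> negligible (\<lambda>l.
              real_prob G l (m l) (C l) (xs l) (t l) (\<alpha> l) -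
              ideal_prob (\<mu> l) (2 ^ n l) (m l) (C l) (xs l) (t l) (\<alpha> l)))"

text \<open>\<open>bt\<close> is the \<open>n\<close>-qubit part of the abort state, which may depend on \<open>l\<close> only.\<close>

definition recognizable_abort :: "(nat \<Rightarrow> nat) \<Rightarrow> (nat \<Rightarrow> nat) \<Rightarrow> generator \<Rightarrow> bool" where
  "recognizable_abort d n G \<longleftrightarrow> (\<exists>(Ghat :: generator) bt. \<forall>l\<ge>1. unit_state (2 ^ n l) (bt l) \<and>
     (\<forall>k x. length k = l \<and> length x = d l \<longrightarrow>
        (\<exists>\<eta> \<psi>. 0 \<le> \<eta> \<and> \<eta> \<le> 1 \<and> unit_state (2 ^ n l) \<psi> \<and>
           Ghat l k x =
             complex_of_real \<eta> \<cdot>\<^sub>m kron (proj (ket_bit False)) (proj \<psi>) +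
             complex_of_real (1 - \<eta>) \<cdot>\<^sub>m kron (proj (ket_bit True)) (proj (bt l))) \<and>
        G l k x = ptrace_first 2 (2 ^ n l) (Ghat l k x)))"


section \<open>Tomography\<close>

text \<open>\<open>T\<close> maps a state of dimension \<open>D\<close> to the distribution of the classical outcome of a quantum
  measurement (POVM), whose effects \<open>E M\<close> sum to the identity entrywise.\<close>

definition is_measurement :: "nat \<Rightarrow> (complex mat \<Rightarrow> 'o pmf) \<Rightarrow> bool" where
  "is_measurement D T \<longleftrightarrow> (\<exists>E.
     (\<forall>M. psd D (E M)) \<and>
     (\<forall>i<D. \<forall>j<D. ((\<lambda>M. E M $$ (i, j)) has_sum (1\<^sub>m D $$ (i, j))) UNIV) \<and>
     (\<forall>\<sigma>. density D \<sigma> \<longrightarrow> (\<forall>M. complex_of_real (pmf (T \<sigma>) M) = mtrace (E M * \<sigma>))))"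

text \<open>\<open>T N s\<close> measures the joint state of \<open>s N\<^sup>2\<close> registers of dimension \<open>N\<close>. Integrability is required
  explicitly because the Bochner integral of a non-integrable function is \<open>0\<close>.\<close>

type_synonym tomography = "nat \<Rightarrow> nat \<Rightarrow> complex mat \<Rightarrow> complex mat pmf"

definition tomography_procedure :: "tomography \<Rightarrow> bool" where
  "tomography_procedure T \<longleftrightarrow> (\<forall>N\<ge>1. \<forall>s\<ge>1.
     is_measurement (N ^ (s * N\<^sup>2)) (T N s) \<and>
     (\<forall>\<sigma>. density (N ^ (s * N\<^sup>2)) \<sigma> \<longrightarrow> set_pmf (T N s \<sigma>) \<subseteq> carrier_mat N N) \<and>
     (\<forall>\<rho>. density N \<rho> \<longrightarrow>
        (let P = T N s (kron_list (replicate (s * N\<^sup>2) \<rho>)) in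
           integrable (measure_pmf P) (\<lambda>M. (frob (M - \<rho>))\<^sup>2) \<and>
           measure_pmf.expectation P (\<lambda>M. (frob (M - \<rho>))\<^sup>2) \<le> real N / real s)))"

definition majority_center :: "real \<Rightarrow> complex mat list \<Rightarrow> nat \<Rightarrow> bool" where
  "majority_center r Ms i \<longleftrightarrow> i < length Ms \<and>
     real (card {j. j < length Ms \<and> (frob (Ms ! j - Ms ! i))\<^sup>2 \<le> r}) > real (length Ms) / 2"

text \<open>The rule by which some admissible index is picked is left open.\<close>

type_synonym picker = "real \<Rightarrow> complex mat list \<Rightarrow> nat"

definition valid_picker :: "picker \<Rightarrow> bool" where
  "valid_picker pick \<longleftrightarrow>
     (\<forall>r Ms. (\<exists>i. majority_center r Ms i) \<longrightarrow> majority_center r Ms (pick r Ms))"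

definition select :: "picker \<Rightarrow> real \<Rightarrow> complex mat list \<Rightarrow> complex mat option" where
  "select pick r Ms = (if \<exists>i. majority_center r Ms i then Some (Ms ! pick r Ms) else None)"

text \<open>The input copies are given as a list of registers in product state, which is cut into \<open>l\<close> blocks
  of \<open>4 s N\<^sup>2\<close> registers; each block goes to an independent run of \<open>T\<close> with parameter \<open>4 s\<close>.
  \<open>None\<close> is the failure symbol.\<close>

definition T_imp ::
  "tomography \<Rightarrow> picker \<Rightarrow> nat \<Rightarrow> nat \<Rightarrow> nat \<Rightarrow> complex mat list \<Rightarrow> complex mat option pmf" where
  "T_imp T pick N s l regs =
     (let B = 4 * s * N\<^sup>2 in
      map_pmf (\<lambda>M. select pick (4 * real N / real s) (map M [0..<l]))
        (Pi_pmf {..<l} (0\<^sub>m 0 0) (\<lambda>j. T N (4 * s) (kron_list (take B (drop (j * B) regs))))))"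

definition Tomography ::
  "tomography \<Rightarrow> picker \<Rightarrow> (nat \<Rightarrow> nat) \<Rightarrow> nat \<Rightarrow> complex mat list \<Rightarrow> complex mat option pmf" where
  "Tomography T pick n l regs = T_imp T pick (2 ^ n l) (2 ^ (n l + 9)) l regs"

type_synonym input = "bool list \<times> bool list \<times> bool"

fun Phi :: "generator \<Rightarrow> nat \<Rightarrow> input \<Rightarrow> complex mat" where
  "Phi G l (k, i, b) = G l k (i @ [b])"

datatype verdict = Valid | Invalid

fun compare_tomograms :: "complex mat option \<Rightarrow> complex mat option \<Rightarrow> verdict" where
  "compare_tomograms (Some M) (Some M') = (if (frob (M - M'))\<^sup>2 \<le> 9 / 128 then Valid else Invalid)"
| "compare_tomograms _ _ = Invalid"

definition Verify ::
  "tomography \<Rightarrow> picker \<Rightarrow> (nat \<Rightarrow> nat) \<Rightarrow> (nat \<Rightarrow> nat) \<Rightarrow> (nat \<Rightarrow> input \<Rightarrow> complex mat)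
    \<Rightarrow> nat \<Rightarrow> input \<Rightarrow> complex mat option \<Rightarrow> verdict pmf" where
  "Verify T pick n L \<Phi> l x M =
     map_pmf (compare_tomograms M) (Tomography T pick n l (replicate (L l) (\<Phi> l x)))"

definition same_input_correct ::
  "(nat \<Rightarrow> nat) \<Rightarrow> (nat \<Rightarrow> nat) \<Rightarrow> (nat \<Rightarrow> input \<Rightarrow> complex mat)
    \<Rightarrow> (nat \<Rightarrow> complex mat list \<Rightarrow> complex mat option pmf)
    \<Rightarrow> (nat \<Rightarrow> input \<Rightarrow> complex mat option \<Rightarrow> verdict pmf) \<Rightarrow> bool" where
  "same_input_correct L d \<Phi> Tom Ver \<longleftrightarrow> (\<exists>\<epsilon>. negligible \<epsilon> \<and>
     (\<forall>l\<ge>1. \<forall>k i b. length k = l \<and> length i = d l \<longrightarrow>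
        measure_pmf.prob
          (bind_pmf (Tom l (replicate (L l) (\<Phi> l (k, i, b)))) (Ver l (k, i, b))) {Valid}
        \<ge> 1 - \<epsilon> l))"

end

theory Submission
  imports Defs "HOL-Real_Asymp.Real_Asymp"
begin

text \<open>One run of the basic procedure is within \<open>q = sqrt (N / s)\<close> of the state with probability at least
  \<open>3 / 4\<close>, by Markov's inequality. All but exponentially often a strict majority of the \<open>l\<close> runs is that
  good, and then the selected matrix is within \<open>3 q\<close> of the state. Two tomograms are therefore within
  \<open>6 q\<close> of each other, and \<open>36 q\<^sup>2 = 36 / 512 = 9 / 128\<close>.\<close>

section \<open>The Frobenius distance\<close>

text \<open>As an \<open>L2_set\<close> over index pairs the norm inherits Minkowski's inequality,
  which gives \<open>frob_triangle\<close>.\<close>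

lemma frob_conv_L2_set:
  assumes "A \<in> carrier_mat m n"
  shows "frob A = L2_set (\<lambda>p. cmod (A $$ p)) ({..<m} \<times> {..<n})"
proof -
  have dims: "dim_row A = m" "dim_col A = n"
    using assms by auto
  show ?thesis
    unfolding frob_def L2_set_def dims sum.cartesian_product
    by (simp add: case_prod_unfold)
qed

lemma frob_nonneg [simp]: "0 \<le> frob A"
  by (simp add: frob_def sum_nonneg)

lemma frob_minus_commute:
  assumes "A \<in> carrier_mat m n" "B \<in> carrier_mat m n"
  shows "frob (A - B) = frob (B - A)"
proof -
  have 1: "A - B \<in> carrier_mat m n" and 2: "B - A \<in> carrier_mat m n"
    using assms by auto
  show ?thesis
    unfolding frob_conv_L2_set[OF 1] frob_conv_L2_set[OF 2]
    using assms by (intro L2_set_cong) (auto simp: norm_minus_commute)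
qed

lemma frob_triangle:
  assumes "A \<in> carrier_mat m n" "B \<in> carrier_mat m n" "C \<in> carrier_mat m n"
  shows "frob (A - C) \<le> frob (A - B) + frob (B - C)"
proof -
  let ?I = "{..<m} \<times> {..<n}"
  have 1: "A - B \<in> carrier_mat m n" and 2: "B - C \<in> carrier_mat m n"
    and 3: "A - C \<in> carrier_mat m n"
    using assms by auto
  have "cmod ((A - C) $$ p) \<le> cmod ((A - B) $$ p) + cmod ((B - C) $$ p)" if "p \<in> ?I" for p
    using that assms norm_triangle_ineq[of "A $$ p - B $$ p" "B $$ p - C $$ p"] by auto
  then have "L2_set (\<lambda>p. cmod ((A - C) $$ p)) ?I
      \<le> L2_set (\<lambda>p. cmod ((A - B) $$ p) + cmod ((B - C) $$ p)) ?I"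
    by (intro L2_set_mono) auto
  also have "\<dots> \<le> L2_set (\<lambda>p. cmod ((A - B) $$ p)) ?I + L2_set (\<lambda>p. cmod ((B - C) $$ p)) ?I"
    by (rule L2_set_triangle_ineq)
  finally show ?thesis
    by (simp add: frob_conv_L2_set[OF 1] frob_conv_L2_set[OF 2] frob_conv_L2_set[OF 3])
qed


section \<open>Tensor powers of states\<close>

text \<open>Sums of rank-one operators replace positive semidefiniteness here because they are visibly closed
  under tensor products; a state with recognizable abort is such a sum with two terms.\<close>

definition rank_one_sum :: "nat \<Rightarrow> complex mat \<Rightarrow> bool" where
  "rank_one_sum D A \<longleftrightarrow> (\<exists>(S :: nat set) V. finite S \<and>
     A = Matrix.mat D D (\<lambda>(i, j). \<Sum>a\<in>S. V a i * cnj (V a j)))"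

text \<open>The quadratic form at \<open>v\<close> splits into squared moduli
  \<open>w a * cnj (w a)\<close>, where \<open>w a\<close> is the inner product of the vector
  \<open>V a\<close> with \<open>v\<close>.\<close>

lemma rank_one_sum_psd:
  assumes "rank_one_sum D A"
  shows "psd D A"
proof -
  obtain S :: "nat set" and V where S: "finite S"
    and A: "A = Matrix.mat D D (\<lambda>(i, j). \<Sum>a\<in>S. V a i * cnj (V a j))"
    using assms by (auto simp: rank_one_sum_def)
  have "0 \<le> (A *\<^sub>v v) \<bullet>c v" if v: "v \<in> carrier_vec D" for v
  proof -
    define w where "w = (\<lambda>a. \<Sum>i<D. V a i * cnj (v $ i))"
    have "(A *\<^sub>v v) \<bullet>c v = (\<Sum>i<D. (\<Sum>j<D. (\<Sum>a\<in>S. V a i * cnj (V a j)) * v $ j) * cnj (v $ i))"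
      using v by (auto simp: A scalar_prod_def atLeast0LessThan intro!: sum.cong)
    also have "\<dots> = (\<Sum>i<D. \<Sum>j<D. \<Sum>a\<in>S. (V a i * cnj (v $ i)) * (cnj (V a j) * v $ j))"
      by (simp add: sum_distrib_right sum_distrib_left mult_ac)
    also have "\<dots> = (\<Sum>i<D. \<Sum>a\<in>S. \<Sum>j<D. (V a i * cnj (v $ i)) * (cnj (V a j) * v $ j))"
      by (intro sum.cong refl sum.swap)
    also have "\<dots> = (\<Sum>a\<in>S. \<Sum>i<D. \<Sum>j<D. (V a i * cnj (v $ i)) * (cnj (V a j) * v $ j))"
      by (rule sum.swap)
    also have "\<dots> = (\<Sum>a\<in>S. w a * cnj (w a))"
      by (simp add: w_def sum_product)
    also have "\<dots> \<ge> 0"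
      by (intro sum_nonneg) (simp add: less_eq_complex_def complex_mult_cnj)
    finally show ?thesis .
  qed
  then show ?thesis
    by (auto simp: psd_def A)
qed

lemma rank_one_sum_one: "rank_one_sum 1 (1\<^sub>m 1)"
  unfolding rank_one_sum_def
  by (rule exI[of _ "{0}"], rule exI[of _ "\<lambda>_ _. 1"]) auto

text \<open>The tensor product is bilinear, and two rank-one operators have as tensor product the
  rank-one operator of the product vector.\<close>

lemma rank_one_sum_kron:
  assumes "rank_one_sum D A" "rank_one_sum E B"
  shows "rank_one_sum (D * E) (kron A B)"
proof -
  obtain S :: "nat set" and V where S: "finite S"
    and A: "A = Matrix.mat D D (\<lambda>(i, j). \<Sum>a\<in>S. V a i * cnj (V a j))"
    using assms(1) by (auto simp: rank_one_sum_def)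
  obtain R :: "nat set" and W where R: "finite R"
    and B: "B = Matrix.mat E E (\<lambda>(i, j). \<Sum>b\<in>R. W b i * cnj (W b j))"
    using assms(2) by (auto simp: rank_one_sum_def)
  \<comment> \<open>\<open>U c\<close> is the tensor product of the two vectors whose indices
    \<open>c\<close> encodes; \<open>div\<close> and \<open>mod\<close> split a basis index into its
    two factors. The pairing code keeps the index set inside the naturals, as
    \<open>rank_one_sum\<close> demands.\<close>
  define U where "U = (\<lambda>c i. V (fst (prod_decode c)) (i div E) * W (snd (prod_decode c)) (i mod E))"
  have "kron A B = Matrix.mat (D * E) (D * E)
      (\<lambda>(i, j). \<Sum>c\<in>prod_encode ` (S \<times> R). U c i * cnj (U c j))"
  proof (rule eq_matI)
    fix i j
    assume "i < dim_row (Matrix.mat (D * E) (D * E)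
        (\<lambda>(i, j). \<Sum>c\<in>prod_encode ` (S \<times> R). U c i * cnj (U c j)))"
      and "j < dim_col (Matrix.mat (D * E) (D * E)
        (\<lambda>(i, j). \<Sum>c\<in>prod_encode ` (S \<times> R). U c i * cnj (U c j)))"
    then have ij: "i < D * E" "j < D * E"
      by auto
    then have "E > 0"
      by (cases E) auto
    with ij have "i div E < D" "j div E < D" "i mod E < E" "j mod E < E"
      by (auto simp: less_mult_imp_div_less)
    with ij have "kron A B $$ (i, j) =
        (\<Sum>a\<in>S. V a (i div E) * cnj (V a (j div E))) * (\<Sum>b\<in>R. W b (i mod E) * cnj (W b (j mod E)))"
      by (simp add: kron_def A B)
    also have "\<dots> = (\<Sum>(a, b)\<in>S \<times> R. (V a (i div E) * W b (i mod E)) *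
        cnj (V a (j div E) * W b (j mod E)))"
      by (simp add: sum_product sum.cartesian_product mult_ac)
    also have "\<dots> = (\<Sum>c\<in>prod_encode ` (S \<times> R). U c i * cnj (U c j))"
      by (subst sum.reindex) (auto simp: U_def inj_prod_encode case_prod_unfold)
    finally show "kron A B $$ (i, j) = Matrix.mat (D * E) (D * E)
        (\<lambda>(i, j). \<Sum>c\<in>prod_encode ` (S \<times> R). U c i * cnj (U c j)) $$ (i, j)"
      using ij by simp
  qed (auto simp: kron_def A B)
  moreover have "finite (prod_encode ` (S \<times> R))"
    using S R by simp
  ultimately show ?thesis
    unfolding rank_one_sum_def by blast
qed

lemma mtrace_kron:
  assumes "A \<in> carrier_mat D D" "B \<in> carrier_mat E E"
  shows "mtrace (kron A B) = mtrace A * mtrace B"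
proof -
  have "mtrace (kron A B) = (\<Sum>i<D * E. A $$ (i div E, i div E) * B $$ (i mod E, i mod E))"
    using assms by (auto simp: mtrace_def kron_def intro!: sum.cong)
  also have "\<dots> = (\<Sum>i<D. \<Sum>j<E. A $$ (i, i) * B $$ (j, j))"
    unfolding sum_mult_product by (intro sum.cong refl) auto
  also have "\<dots> = mtrace A * mtrace B"
    using assms by (simp add: mtrace_def sum_product)
  finally show ?thesis .
qed

text \<open>\<open>tomography_procedure\<close> guarantees the dimensions of an outcome only when
  the joint state of all copies is a density, so this must be known for tensor powers.\<close>

lemma density_kron_power:
  assumes "rank_one_sum D \<rho>" "mtrace \<rho> = 1"
  shows "density (D ^ m) (kron_list (replicate m \<rho>))"
proof -
  have "rank_one_sum (D ^ m) (kron_list (replicate m \<rho>)) \<and> mtrace (kron_list (replicate m \<rho>)) = 1"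
  proof (induction m)
    case 0
    then show ?case
      using rank_one_sum_one by (simp add: kron_list_def mtrace_def)
  next
    case (Suc m)
    have step: "kron_list (replicate (Suc m) \<rho>) = kron \<rho> (kron_list (replicate m \<rho>))"
      by (simp add: kron_list_def)
    have "\<rho> \<in> carrier_mat D D" "kron_list (replicate m \<rho>) \<in> carrier_mat (D ^ m) (D ^ m)"
      using assms(1) Suc rank_one_sum_psd psd_def by blast+
    then show ?case
      unfolding step using Suc assms by (simp add: rank_one_sum_kron mtrace_kron)
  qed
  then show ?thesis
    by (simp add: density_def rank_one_sum_psd)
qed

text \<open>Tracing out the flag qubit leaves the mixture of \<psi> and \<phi> with weights \<eta>
  and 1 - \<eta>. The square roots of the weights are absorbed into the two vectors.\<close>

lemma rank_one_sum_abort: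
  assumes "0 \<le> \<eta>" "\<eta> \<le> 1" "\<psi> \<in> carrier_vec D" "\<phi> \<in> carrier_vec D"
  shows "rank_one_sum D (ptrace_first 2 D
     (complex_of_real \<eta> \<cdot>\<^sub>m kron (proj (ket_bit False)) (proj \<psi>) +
      complex_of_real (1 - \<eta>) \<cdot>\<^sub>m kron (proj (ket_bit True)) (proj \<phi>)))" (is "rank_one_sum D ?A")
proof -
  define V where "V = (\<lambda>(a::nat) i. if a = 0 then complex_of_real (sqrt \<eta>) * \<psi> $ i
    else complex_of_real (sqrt (1 - \<eta>)) * \<phi> $ i)"
  have sq: "complex_of_real (sqrt x) * complex_of_real (sqrt x) = complex_of_real x" if "0 \<le> x" for x
    using that by (metis of_real_mult real_sqrt_mult_self abs_of_nonneg)
  have "?A = Matrix.mat D D (\<lambda>(i, j). \<Sum>a\<in>{0, 1}. V a i * cnj (V a j))"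
  proof (rule eq_matI)
    fix i j
    assume "i < dim_row (Matrix.mat D D (\<lambda>(i, j). \<Sum>a\<in>{0, 1}. V a i * cnj (V a j)))"
      and "j < dim_col (Matrix.mat D D (\<lambda>(i, j). \<Sum>a\<in>{0, 1}. V a i * cnj (V a j)))"
    then have ij: "i < D" "j < D"
      by auto
    have dims: "dim_vec \<psi> = D" "dim_vec \<phi> = D" "dim_vec (ket_bit b) = 2" for b
      using assms by (auto simp: ket_bit_def)
    have "?A $$ (i, j) = complex_of_real \<eta> * (\<psi> $ i * cnj (\<psi> $ j))
        + complex_of_real (1 - \<eta>) * (\<phi> $ i * cnj (\<phi> $ j))"
      using ij dims
      by (simp add: ptrace_first_def numeral_2_eq_2 kron_def proj_def ket_bit_def)
    also have "\<dots> = (complex_of_real (sqrt \<eta>) * complex_of_real (sqrt \<eta>)) * (\<psi> $ i * cnj (\<psi> $ j))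
        + (complex_of_real (sqrt (1 - \<eta>)) * complex_of_real (sqrt (1 - \<eta>))) * (\<phi> $ i * cnj (\<phi> $ j))"
      using assms(1,2) by (simp only: sq diff_ge_0_iff_ge)
    also have "\<dots> = (\<Sum>a\<in>{0, 1}. V a i * cnj (V a j))"
      by (simp add: V_def mult_ac)
    finally show "?A $$ (i, j) = Matrix.mat D D (\<lambda>(i, j). \<Sum>a\<in>{0, 1}. V a i * cnj (V a j)) $$ (i, j)"
      using ij by simp
  qed (simp_all add: ptrace_first_def)
  then show ?thesis
    unfolding rank_one_sum_def by (intro exI[of _ "{0, 1}"] exI[of _ V] conjI) simp
qed


section \<open>Amplification by majority\<close>

text \<open>\<open>A\<close> collects the bad outcomes, and ties count as failure. By independence
  the expectation of \<open>u\<close> is a power of a single expectation, which is at most 1 + 2/4;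
  Markov's inequality at the threshold \<open>sqrt 3 ^ l\<close> then gives the bound.\<close>

lemma prob_Pi_pmf_majority_le:
  fixes p :: "'a pmf"
  assumes "measure_pmf.prob p A \<le> 1 / 4"
  shows "measure_pmf.prob (Pi_pmf {..<l} dflt (\<lambda>_. p)) {f. l \<le> 2 * card {j. j < l \<and> f j \<in> A}}
    \<le> (sqrt 3 / 2) ^ l"
proof -
  let ?P = "Pi_pmf {..<l} dflt (\<lambda>_. p)"
  define g where "g = (\<lambda>x. 1 + 2 * indicator A x :: real)"
  define u where "u = (\<lambda>f. \<Prod>j<l. g (f j))"
  \<comment> \<open>a Chernoff bound: any base in \<open>(1, 9)\<close> makes \<open>u\<close> decay, \<open>3\<close> is optimal\<close>
  have u_eq: "u f = 3 ^ card {j. j < l \<and> f j \<in> A}" for f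
  proof -
    have "u f = (\<Prod>j<l. if f j \<in> A then 3 else 1)"
      unfolding u_def g_def by (intro prod.cong) auto
    also have "\<dots> = 3 ^ card ({..<l} \<inter> {j. f j \<in> A})"
      by (simp add: prod.If_cases)
    also have "{..<l} \<inter> {j. f j \<in> A} = {j. j < l \<and> f j \<in> A}"
      by auto
    finally show ?thesis .
  qed
  have u_ge: "u f \<ge> sqrt 3 ^ l" if "l \<le> 2 * card {j. j < l \<and> f j \<in> A}" for f
  proof -
    have "sqrt 3 ^ l \<le> sqrt 3 ^ (2 * card {j. j < l \<and> f j \<in> A})"
      using that by (intro power_increasing) auto
    then show ?thesis
      by (simp add: u_eq power_mult)
  qed
  \<comment> \<open>A bound on \<open>u\<close> makes it integrable, as Markov's inequality
    requires.\<close>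
  have u_le: "u f \<le> 3 ^ l" for f
  proof -
    have "card {j. j < l \<and> f j \<in> A} \<le> card {..<l}"
      by (intro card_mono) auto
    then show ?thesis
      by (simp add: u_eq)
  qed
  have int_u: "integrable (measure_pmf ?P) u"
    by (rule measure_pmf.integrable_const_bound[where B = "3 ^ l"]) (use u_le in \<open>auto simp: u_eq\<close>)
  have int_g: "integrable (measure_pmf p) g"
    by (rule measure_pmf.integrable_const_bound[where B = 3]) (auto simp: g_def indicator_def)
  have "measure_pmf.expectation p g = 1 + 2 * measure_pmf.prob p A"
    unfolding g_def by (subst Bochner_Integration.integral_add) (auto simp: measure_pmf.emeasure_eq_measure)
  then have g_le: "measure_pmf.expectation p g \<le> 3 / 2"
    using assms by simp
  have g_nonneg: "0 \<le> g x" for x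
    by (simp add: g_def)
  have "measure_pmf.expectation ?P u = measure_pmf.expectation p g ^ l"
    unfolding u_def using int_g g_nonneg by (subst expectation_prod_Pi_pmf) auto
  also have "\<dots> \<le> (3 / 2) ^ l"
    using g_le g_nonneg by (intro power_mono integral_nonneg_AE) auto
  finally have Eu: "measure_pmf.expectation ?P u \<le> (3 / 2) ^ l" .
  have "measure_pmf.prob ?P {f. l \<le> 2 * card {j. j < l \<and> f j \<in> A}}
      \<le> measure_pmf.prob ?P {f \<in> space (measure_pmf ?P). sqrt 3 ^ l \<le> u f}"
    using u_ge by (intro measure_pmf.finite_measure_mono) auto
  also have "\<dots> \<le> measure_pmf.expectation ?P u / sqrt 3 ^ l"
    using int_u by (intro integral_Markov_inequality_measure[where A = "{}"]) (auto simp: u_def g_nonneg prod_nonneg)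
  also have "\<dots> \<le> (3 / 2) ^ l / sqrt 3 ^ l"
    using Eu by (simp add: divide_right_mono)
  also have "\<dots> = (3 / 2 / sqrt 3) ^ l"
    by (simp only: power_divide)
  also have "3 / 2 / sqrt 3 = sqrt 3 / 2"
    by (simp add: field_simps)
  finally show ?thesis .
qed

text \<open>Two good matrices are within \<open>2 q\<close> of each other, so every good one is an admissible center;
  and a majority always contains a good one, so every admissible center is within \<open>2 q + q\<close> of \<open>\<rho>\<close>.\<close>

lemma select_close:
  assumes pick: "valid_picker pick"
    and Ms: "\<And>j. j < length Ms \<Longrightarrow> Ms ! j \<in> carrier_mat N N" and \<rho>: "\<rho> \<in> carrier_mat N N"
    and "0 \<le> q"
    and bad: "2 * card {j. j < length Ms \<and> q < frob (Ms ! j - \<rho>)} < length Ms"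
  shows "\<exists>M. select pick ((2 * q)\<^sup>2) Ms = Some M \<and> M \<in> carrier_mat N N \<and> frob (M - \<rho>) \<le> 3 * q"
proof -
  let ?r = "(2 * q)\<^sup>2"
  let ?good = "{j. j < length Ms \<and> frob (Ms ! j - \<rho>) \<le> q}"
  let ?bad = "{j. j < length Ms \<and> q < frob (Ms ! j - \<rho>)}"
  let ?near = "\<lambda>i. {j. j < length Ms \<and> (frob (Ms ! j - Ms ! i))\<^sup>2 \<le> ?r}"
  have near_iff: "(frob A)\<^sup>2 \<le> ?r \<longleftrightarrow> frob A \<le> 2 * q" for A
    using \<open>0 \<le> q\<close> using abs_le_square_iff[of "frob A" "2 * q"] by simp
  have "card ?good + card ?bad = card (?good \<union> ?bad)"
    by (subst card_Un_disjoint) auto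
  also have "?good \<union> ?bad = {..<length Ms}"
    by auto
  finally have good: "length Ms < 2 * card ?good"
    using bad by simp
  then obtain g where g: "g \<in> ?good"
    by (metis (no_types, lifting) card.empty ex_in_conv mult_0_right not_less_zero)
  have "?good \<subseteq> ?near g"
  proof
    fix j assume j: "j \<in> ?good"
    have "frob (Ms ! j - Ms ! g) \<le> frob (Ms ! j - \<rho>) + frob (\<rho> - Ms ! g)"
      using j g Ms \<rho> by (intro frob_triangle) auto
    also have "frob (\<rho> - Ms ! g) = frob (Ms ! g - \<rho>)"
      using g Ms \<rho> by (intro frob_minus_commute) auto
    finally show "j \<in> ?near g"
      using j g unfolding near_iff by auto
  qed
  then have "card ?good \<le> card (?near g)"
    by (intro card_mono) auto
  with good g have "majority_center ?r Ms g"
    by (auto simp: majority_center_def)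
  then have ex: "\<exists>i. majority_center ?r Ms i" ..
  define i where "i = pick ?r Ms"
  have i: "majority_center ?r Ms i"
    using ex pick by (simp add: valid_picker_def i_def)
  \<comment> \<open>Inclusion-exclusion: two sets that each contain more than half of the indices
    share some \<open>j\<close>. It links the arbitrarily picked center \<open>i\<close> to
    \<rho>.\<close>
  then have "length Ms < card ?good + card (?near i)"
    using good by (auto simp: majority_center_def)
  moreover have "card (?good \<union> ?near i) \<le> card {..<length Ms}"
    by (intro card_mono) auto
  moreover have "card ?good + card (?near i) = card (?good \<union> ?near i) + card (?good \<inter> ?near i)"
    by (rule card_Un_Int) auto
  ultimately have "card (?good \<inter> ?near i) \<noteq> 0"
    unfolding card_lessThan by linarith
  then obtain j where j: "j \<in> ?good" "j \<in> ?near i"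
    by (metis (no_types, lifting) card.empty ex_in_conv IntE)
  have il: "i < length Ms"
    using i by (simp add: majority_center_def)
  have "frob (Ms ! i - \<rho>) \<le> frob (Ms ! i - Ms ! j) + frob (Ms ! j - \<rho>)"
    using j il Ms \<rho> by (intro frob_triangle) auto
  also have "frob (Ms ! i - Ms ! j) = frob (Ms ! j - Ms ! i)"
    using j il Ms by (intro frob_minus_commute[of _ N N]) auto
  finally have "frob (Ms ! i - \<rho>) \<le> 3 * q"
    using j unfolding near_iff by auto
  moreover have "select pick ?r Ms = Some (Ms ! i)"
    using ex by (simp only: select_def i_def if_True)
  ultimately show ?thesis
    using il Ms by blast
qed

text \<open>The failure symbol counts as inaccurate. The dimensions are recorded because the
  triangle inequality for \<open>frob\<close> is stated for matrices of a common size.\<close>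

definition accurate :: "nat \<Rightarrow> complex mat \<Rightarrow> real \<Rightarrow> complex mat option \<Rightarrow> bool" where
  "accurate N \<rho> q z \<longleftrightarrow> (\<exists>M. z = Some M \<and> M \<in> carrier_mat N N \<and> frob (M - \<rho>) \<le> q)"

lemma T_imp_accurate:
  assumes T: "tomography_procedure T" and pick: "valid_picker pick"
    and "1 \<le> N" "1 \<le> s" and \<rho>: "rank_one_sum N \<rho>" "mtrace \<rho> = 1"
  shows "measure_pmf.prob (T_imp T pick N s l (replicate (4 * s * N\<^sup>2 * l) \<rho>))
      {z. \<not> accurate N \<rho> (3 * sqrt (real N / real s)) z} \<le> (sqrt 3 / 2) ^ l"
proof -
  define B where "B = 4 * s * N\<^sup>2"
  define p where "p = T N (4 * s) (kron_list (replicate B \<rho>))"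
  define q where "q = sqrt (real N / real s)"
  let ?A = "{M. q < frob (M - \<rho>)}"
  let ?P = "Pi_pmf {..<l} (0\<^sub>m 0 0) (\<lambda>_. p)"
  have q: "q > 0" "q\<^sup>2 = real N / real s"
    using assms by (auto simp: q_def)
  have dens: "density N \<rho>" and \<rho>_carrier: "\<rho> \<in> carrier_mat N N"
    using \<rho> rank_one_sum_psd by (auto simp: density_def psd_def)
  have T': "set_pmf p \<subseteq> carrier_mat N N \<and>
      integrable (measure_pmf p) (\<lambda>M. (frob (M - \<rho>))\<^sup>2) \<and>
      measure_pmf.expectation p (\<lambda>M. (frob (M - \<rho>))\<^sup>2) \<le> real N / real (4 * s)"
    using T[unfolded tomography_procedure_def, rule_format, of N "4 * s"]
      density_kron_power[OF \<rho>, of B] dens assms(3,4)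
    by (auto simp: Let_def p_def B_def)
  \<comment> \<open>A run with parameter \<open>4 * s\<close> has mean squared error at most N/(4s),
    a quarter of the squared radius; hence the bound 1/4.\<close>
  have "measure_pmf.prob p ?A \<le> measure_pmf.prob p {M \<in> space (measure_pmf p). q\<^sup>2 \<le> (frob (M - \<rho>))\<^sup>2}"
    using q(1) by (intro measure_pmf.finite_measure_mono) (auto intro!: power_mono)
  also have "\<dots> \<le> measure_pmf.expectation p (\<lambda>M. (frob (M - \<rho>))\<^sup>2) / q\<^sup>2"
    using T' q(1) by (intro integral_Markov_inequality_measure[where A = "{}"]) auto
  also have "\<dots> \<le> (real N / real (4 * s)) / q\<^sup>2"
    using T' by (intro divide_right_mono) auto
  also have "\<dots> = 1 / 4"
    using assms(3,4) by (simp add: q)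
  finally have bad: "measure_pmf.prob p ?A \<le> 1 / 4" .
  \<comment> \<open>The number of registers is exactly \<open>B * l\<close>, so after dropping
    \<open>j * B\<close> of them with j < l a full block remains. All runs are therefore identically
    distributed.\<close>
  have blocks: "take B (drop (j * B) (replicate (B * l) \<rho>)) = replicate B \<rho>" if "j < l" for j
  proof -
    have "B \<le> B * l - j * B"
      using that by (metis diff_mult_distrib2 less_eq_Suc_le mult.commute mult_le_mono2 mult.right_neutral
          zero_less_diff One_nat_def)
    then show ?thesis
      by simp
  qed
  have Pi_eq: "Pi_pmf {..<l} (0\<^sub>m 0 0)
      (\<lambda>j. T N (4 * s) (kron_list (take B (drop (j * B) (replicate (B * l) \<rho>))))) = ?P"
    by (intro Pi_pmf_cong) (simp_all add: blocks p_def del: take_replicate drop_replicate)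
  \<comment> \<open>The acceptance radius of the selection is the squared diameter of the ball of
    good matrices, the form that \<open>select_close\<close> expects.\<close>
  have r: "4 * real N / real s = (2 * q)\<^sup>2"
    by (simp add: power_mult_distrib q)
  have "measure_pmf.prob (T_imp T pick N s l (replicate (B * l) \<rho>)) {z. \<not> accurate N \<rho> (3 * q) z}
     = measure_pmf.prob ?P {f. \<not> accurate N \<rho> (3 * q) (select pick ((2 * q)\<^sup>2) (map f [0..<l]))}"
    unfolding T_imp_def Let_def B_def[symmetric] Pi_eq r by (simp add: vimage_def)
  also have "\<dots> \<le> measure_pmf.prob ?P {f. l \<le> 2 * card {j. j < l \<and> f j \<in> ?A}}"
  \<comment> \<open>The inclusion of events is shown only on the support, where each outcome is
    known to be an N by N matrix. The default \<open>0\<^sub>m 0 0\<close> sits outside the indices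
    below \<open>l\<close> and never reaches the list.\<close>
  proof (rule measure_pmf.finite_measure_mono_AE)
    show "AE f in measure_pmf ?P.
        f \<in> {f. \<not> accurate N \<rho> (3 * q) (select pick ((2 * q)\<^sup>2) (map f [0..<l]))} \<longrightarrow>
        f \<in> {f. l \<le> 2 * card {j. j < l \<and> f j \<in> ?A}}"
    proof (rule AE_pmfI, rule impI, rule ccontr)
      fix f
      assume f: "f \<in> set_pmf ?P"
        and inacc: "f \<in> {f. \<not> accurate N \<rho> (3 * q) (select pick ((2 * q)\<^sup>2) (map f [0..<l]))}"
        and maj: "f \<notin> {f. l \<le> 2 * card {j. j < l \<and> f j \<in> ?A}}"
      have "f j \<in> carrier_mat N N" if "j < l" for j
        using f that T' by (auto simp: set_Pi_pmf PiE_dflt_def)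
      moreover have "{j. j < l \<and> q < frob (map f [0..<l] ! j - \<rho>)} = {j. j < l \<and> f j \<in> ?A}"
        by auto
      ultimately have "accurate N \<rho> (3 * q) (select pick ((2 * q)\<^sup>2) (map f [0..<l]))"
        unfolding accurate_def using pick \<rho>_carrier q maj by (intro select_close) auto
      with inacc show False
        by simp
    qed
  qed auto
  also have "\<dots> \<le> (sqrt 3 / 2) ^ l"
    by (rule prob_Pi_pmf_majority_le[OF bad])
  finally show ?thesis
    by (simp add: B_def q_def)
qed

section \<open>Agreement of two independent tomograms\<close>

lemma compare_tomograms_accurate:
  assumes "accurate N \<rho> q z" "accurate N \<rho> q z'" and "\<rho> \<in> carrier_mat N N"
    and "(2 * q)\<^sup>2 \<le> 9 / 128"
  shows "compare_tomograms z z' = Valid"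
proof -
  obtain M M' where M: "z = Some M" "M \<in> carrier_mat N N" "frob (M - \<rho>) \<le> q"
    and M': "z' = Some M'" "M' \<in> carrier_mat N N" "frob (M' - \<rho>) \<le> q"
    using assms by (auto simp: accurate_def)
  have "frob (M - M') \<le> frob (M - \<rho>) + frob (\<rho> - M')"
    using M M' assms by (intro frob_triangle) auto
  also have "frob (\<rho> - M') = frob (M' - \<rho>)"
    using M' assms by (intro frob_minus_commute) auto
  finally have "(frob (M - M'))\<^sup>2 \<le> (2 * q)\<^sup>2"
    using M M' by (intro power_mono) auto
  then show ?thesis
    using M M' assms by simp
qed

text \<open>Verification draws a second, independent sample from the same distribution, so the
  experiment is a sample of \<open>pair_pmf p p\<close>. A union bound over its two marginals costs
  \<open>e\<close> each.\<close>

lemma prob_bind_self_ge: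
  fixes p :: "'a pmf"
  assumes "\<And>x y. x \<in> A \<Longrightarrow> y \<in> A \<Longrightarrow> f x y = v" and "measure_pmf.prob p (- A) \<le> e"
  shows "measure_pmf.prob (bind_pmf p (\<lambda>x. map_pmf (f x) p)) {v} \<ge> 1 - 2 * e"
proof -
  let ?Q = "pair_pmf p p"
  have "bind_pmf p (\<lambda>x. map_pmf (f x) p) = map_pmf (\<lambda>(x, y). f x y) ?Q"
    by (simp add: pair_pmf_def map_bind_pmf map_pmf_def bind_assoc_pmf bind_return_pmf)
  then have eq: "measure_pmf.prob (bind_pmf p (\<lambda>x. map_pmf (f x) p)) {v}
      = 1 - measure_pmf.prob ?Q (- ((\<lambda>(x, y). f x y) -` {v}))"
    using measure_pmf.prob_compl[of "(\<lambda>(x, y). f x y) -` {v}" ?Q] by (simp add: Compl_eq_Diff_UNIV)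
  have "measure_pmf.prob ?Q (- ((\<lambda>(x, y). f x y) -` {v}))
      \<le> measure_pmf.prob ?Q (fst -` (- A) \<union> snd -` (- A))"
    using assms(1) by (intro measure_pmf.finite_measure_mono) auto
  also have "\<dots> \<le> measure_pmf.prob ?Q (fst -` (- A)) + measure_pmf.prob ?Q (snd -` (- A))"
    by (intro measure_Un_le) auto
  also have "\<dots> = measure_pmf.prob (map_pmf fst ?Q) (- A) + measure_pmf.prob (map_pmf snd ?Q) (- A)"
    by simp
  also have "\<dots> \<le> 2 * e"
    using assms(2) by (simp add: map_fst_pair_pmf map_snd_pair_pmf)
  finally show ?thesis
    unfolding eq by simp
qed

section \<open>Negligible error and the correctness of the scheme\<close>

lemma negligible_geometric:
  assumes "0 < c" "c < (1 :: real)"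
  shows "negligible (\<lambda>l. a * c ^ l)"
  unfolding negligible_def
proof
  fix k :: nat
  have "(\<lambda>l. \<bar>a\<bar> * (c ^ l * real l ^ k)) \<longlonglongrightarrow> \<bar>a\<bar> * 0"
    using assms by (intro tendsto_mult tendsto_const) real_asymp
  then have "\<forall>\<^sub>F l in sequentially. \<bar>a\<bar> * (c ^ l * real l ^ k) < 1"
    by (rule order_tendstoD) simp
  \<comment> \<open>Dividing by \<open>real l ^ k\<close> needs l > 0.\<close>
  with eventually_gt_at_top[of 0] show "\<forall>\<^sub>F l in sequentially. \<bar>a * c ^ l\<bar> < 1 / real l ^ k"
    by eventually_elim (use assms in \<open>simp add: abs_mult field_simps\<close>)
qed

theorem lemma7p10:
  fixes G :: generator and T :: tomography and pick :: picker
    and d n L :: "nat \<Rightarrow> nat"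
  assumes d: "\<And>l. d l = clog2 l"
    and n: "\<And>l. n l = clog2 l"
    and L: "\<And>l. L l = 2 ^ (3 * n l + 11) * l"
    and prfs: "prfs (\<lambda>l. d l + 1) n G"
    and abort: "recognizable_abort (\<lambda>l. d l + 1) n G"
    and T: "tomography_procedure T"
    and pick: "valid_picker pick"
  shows "same_input_correct L d (Phi G) (Tomography T pick n) (Verify T pick n L (Phi G))"
proof -
  \<comment> \<open>Since sqrt 4 = 2, the base \<open>sqrt 3 / 2\<close> of the error is below
    1.\<close>
  have "sqrt 3 < sqrt 4"
    by (intro real_sqrt_less_mono) simp
  then have "negligible (\<lambda>l. 2 * (sqrt 3 / 2) ^ l)"
    by (intro negligible_geometric) auto
  moreover have "measure_pmf.prob
      (bind_pmf (Tomography T pick n l (replicate (L l) (Phi G l (k, i, b))))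
        (Verify T pick n L (Phi G) l (k, i, b))) {Valid} \<ge> 1 - 2 * (sqrt 3 / 2) ^ l"
    if l: "1 \<le> l" and "length k = l" "length i = d l" for l k i b
  proof -
    define \<rho> where "\<rho> = Phi G l (k, i, b)"
    define N :: nat where "N = 2 ^ n l"
    define s :: nat where "s = 2 ^ (n l + 9)"
    \<comment> \<open>This \<open>q\<close> is the radius after selection, three times the radius of
      a single good run.\<close>
    define q where "q = 3 * sqrt (real N / real s)"
    have len: "length (i @ [b]) = d l + 1"
      using that by simp
    \<comment> \<open>The trace and the dimensions of \<rho> come from the generator clause of
      \<open>prfs\<close>; recognizable abort supplies the rank-one decomposition below.\<close>
    have "density N \<rho>"
      using prfs l len \<open>length k = l\<close> unfolding prfs_def qpt_generator_def N_def \<rho>_def Phi.simps by blast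
    then have tr: "mtrace \<rho> = 1" and carrier: "\<rho> \<in> carrier_mat N N"
      by (auto simp: density_def psd_def)
    have ros: "rank_one_sum N \<rho>"
      using abort l len \<open>length k = l\<close>
      unfolding recognizable_abort_def N_def \<rho>_def Phi.simps unit_state_def
      by (metis rank_one_sum_abort)
    \<comment> \<open>The exponents add up: 4 contributes 2, \<open>s\<close> contributes n + 9 and
      the square of \<open>N\<close> contributes 2n, in total 3n + 11.\<close>
    have "4 * s * N\<^sup>2 * l = L l"
      by (simp add: L N_def s_def power_add power_mult power2_eq_square power3_eq_cube
          mult.commute[of 3] flip: power_mult_distrib)
    then have "measure_pmf.prob (Tomography T pick n l (replicate (L l) \<rho>)) {z. \<not> accurate N \<rho> q z}
        \<le> (sqrt 3 / 2) ^ l"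
      using T_imp_accurate[OF T pick _ _ ros tr, of s l]
      by (simp add: Tomography_def N_def s_def q_def)
    also have "{z. \<not> accurate N \<rho> q z} = - {z. accurate N \<rho> q z}"
      by auto
    finally have inaccurate: "measure_pmf.prob (Tomography T pick n l (replicate (L l) \<rho>))
        (- {z. accurate N \<rho> q z}) \<le> (sqrt 3 / 2) ^ l" .
    \<comment> \<open>N/s is 1/512 for every \<open>l\<close>, so the threshold of the verifier is
      met with equality.\<close>
    have "(2 * q)\<^sup>2 \<le> 9 / 128"
      by (simp add: q_def N_def s_def power_mult_distrib power_add)
    then have "compare_tomograms z z' = Valid"
      if "z \<in> {z. accurate N \<rho> q z}" "z' \<in> {z. accurate N \<rho> q z}" for z z'
      using that carrier compare_tomograms_accurate by blast
    from prob_bind_self_ge[OF this inaccurate] show ?thesis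
      unfolding Verify_def \<rho>_def .
  qed
  ultimately show ?thesis
    unfolding same_input_correct_def by blast
qed

end
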